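(* Let $p,g_1,\ldots,g_m$ be real polynomials in $n$ variables, $S=\{x\in\mathbb{R}^n: g_i(x)\ge0,\ i=1,\ldots,m\}$, $p^*=\inf_{x\in S}p(x)$, and let $d,R,\eta_i,\beta$ and $f_\gamma$ be as in the context; put $N=n+m+3$, $D=2d$. For $r\ge1$ let $\mathrm{Pol}^r_{N,2D}$ be the set of forms $q$ in $N$ variables of degree $2D$ such that the polynomial $$\left(q(v^2-w^2)+\frac1{2r}\Big(\sum_{i=1}^N(v_i^4+w_i^4)\Big)^D\right)\cdot\Big(\sum_{i=1}^N v_i^2+\sum_{i=1}^N w_i^2\Big)^{r^2}$$ in $(v,w)\in\mathbb{R}^{2N}$ has nonnegative coefficients. Define $$l_r:=\sup\Big\{\gamma\in\mathbb{R}: f_\gamma(z)-\tfrac1r\Big(\sum_{i=1}^N z_i^2\Big)^D\in \mathrm{Pol}^r_{N,2D}\Big\},\qquad m_r:=\max_{i=1,\ldots,r}l_i .$$ Then $m_r\le p^*$ for all $r$, $\{m_r\}$ is nondecreasing, and $\lim_{r\to\infty}m_r=p^*$.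
   Context: $q(v^2-w^2)$ denotes $q(v_1^2-w_1^2,\ldots,v_N^2-w_N^2)$. Data of the polynomial optimization problem $\inf_{x\in S}p(x)$: $d\ge1$ is such that $2d$ is the smallest positive even integer larger than or equal to the maximum degree of $p,g_1,\ldots,g_m$; $R>0$ satisfies $\sum_i x_i^2\le R$ for all $x\in S$; $\eta_i,\beta\in\mathbb{R}$ satisfy $g_i(x)\le\eta_i$ and $-p(x)\le\beta$ for all $x\in S$. With $z=(z_1,\ldots,z_N)=(x_1,\ldots,x_n,s_0,\ldots,s_{m+1},y)$, $$f_\gamma(z):=\left(\gamma y^{2d}-y^{2d}p(x/y)-s_0^2y^{2d-2}\right)^2+\sum_{i=1}^m\left(y^{2d}g_i(x/y)-s_i^2y^{2d-2}\right)^2+\left(\Big(R+\sum_{i=1}^m\eta_i+\beta+\gamma\Big)^dy^{2d}-\Big(\sum_{i=1}^n x_i^2+\sum_{i=0}^m s_i^2\Big)^d-s_{m+1}^{2d}\right)^2 ,$$ a form of degree $4d=2D$ in $N=n+m+3$ variables, where $y^{2d}q(x/y)$ is the degree-$2d$ homogenization of $q$. Convention: $\sup\emptyset=-\infty$. *)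

theory Defs
  imports "HOL-Analysis.Analysis" "HOL-Library.Poly_Mapping"
begin

text \<open>
  A monomial is a finitely supported exponent function, and a polynomial is a finitely supported
  function from monomials to real coefficients; the ring structure is the convolution ring of
  \<^theory>\<open>HOL-Library.Poly_Mapping\<close>.  Variables are indexed by natural numbers,
  and a polynomial in \<open>n\<close> variables is one whose variables lie in \<open>{..<n}\<close>.
\<close>

type_synonym mpoly = "(nat \<Rightarrow>\<^sub>0 nat) \<Rightarrow>\<^sub>0 real"

definition mp_const :: "real \<Rightarrow> mpoly" where
  "mp_const c = Poly_Mapping.single 0 c"

definition mp_var :: "nat \<Rightarrow> mpoly" where
  "mp_var i = Poly_Mapping.single (Poly_Mapping.single i 1) 1"

definition mp_coeff :: "mpoly \<Rightarrow> (nat \<Rightarrow>\<^sub>0 nat) \<Rightarrow> real" where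
  "mp_coeff p a = Poly_Mapping.lookup p a"

definition mono_degree :: "(nat \<Rightarrow>\<^sub>0 nat) \<Rightarrow> nat" where
  "mono_degree a = (\<Sum>i\<in>Poly_Mapping.keys a. Poly_Mapping.lookup a i)"

definition mp_vars :: "mpoly \<Rightarrow> nat set" where
  "mp_vars p = (\<Union>a\<in>Poly_Mapping.keys p. Poly_Mapping.keys a)"

text \<open>The total degree; the zero polynomial gets degree \<open>0\<close>.\<close>

definition mp_degree :: "mpoly \<Rightarrow> nat" where
  "mp_degree p = Max (insert 0 (mono_degree ` Poly_Mapping.keys p))"

definition mp_eval :: "(nat \<Rightarrow> real) \<Rightarrow> mpoly \<Rightarrow> real" where
  "mp_eval x p = (\<Sum>a\<in>Poly_Mapping.keys p.
     mp_coeff p a * (\<Prod>i\<in>Poly_Mapping.keys a. x i ^ Poly_Mapping.lookup a i))"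

definition mp_subst :: "(nat \<Rightarrow> mpoly) \<Rightarrow> mpoly \<Rightarrow> mpoly" where
  "mp_subst \<sigma> p = (\<Sum>a\<in>Poly_Mapping.keys p.
     mp_const (mp_coeff p a) * (\<Prod>i\<in>Poly_Mapping.keys a. \<sigma> i ^ Poly_Mapping.lookup a i))"

text \<open>Forms of degree \<open>k\<close> in \<open>N\<close> variables, the zero polynomial included.\<close>

definition is_form :: "nat \<Rightarrow> nat \<Rightarrow> mpoly \<Rightarrow> bool" where
  "is_form N k q \<longleftrightarrow> mp_vars q \<subseteq> {..<N} \<and> (\<forall>a\<in>Poly_Mapping.keys q. mono_degree a = k)"

text \<open>
  \<open>homogenize k y q\<close> is \<open>y\<^sup>k q(x/y)\<close>, where \<open>y\<close> is the index of the homogenizing variable.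
  The truncating subtraction is harmless when \<open>k\<close> is at least the degree of \<open>q\<close>.
\<close>

definition homogenize :: "nat \<Rightarrow> nat \<Rightarrow> mpoly \<Rightarrow> mpoly" where
  "homogenize k y q = (\<Sum>a\<in>Poly_Mapping.keys q.
     Poly_Mapping.single (a + Poly_Mapping.single y (k - mono_degree a)) (mp_coeff q a))"

text \<open>Points of \<open>\<real>\<^sup>n\<close> are the functions that are unconstrained on \<open>{..<n}\<close> and \<open>undefined\<close> elsewhere.\<close>

definition feasible_set :: "nat \<Rightarrow> nat \<Rightarrow> (nat \<Rightarrow> mpoly) \<Rightarrow> (nat \<Rightarrow> real) set" where
  "feasible_set n m g = {x \<in> {..<n} \<rightarrow>\<^sub>E UNIV. \<forall>i\<in>{1..m}. mp_eval x (g i) \<ge> 0}"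

text \<open>The infimum is taken in the extended reals, so it is \<open>\<infinity>\<close> for an empty feasible set.\<close>

definition opt_value :: "nat \<Rightarrow> nat \<Rightarrow> mpoly \<Rightarrow> (nat \<Rightarrow> mpoly) \<Rightarrow> ereal" where
  "opt_value n m p g = (INF x\<in>feasible_set n m g. ereal (mp_eval x p))"

text \<open>
  The \<open>n + m + 3\<close> variables \<open>z = (x\<^sub>1, \<dots>, x\<^sub>n, s\<^sub>0, \<dots>, s\<^sub>m\<^sub>+\<^sub>1, y)\<close> are numbered from \<open>0\<close>:
  the \<open>x\<close> block is \<open>{..<n}\<close>, \<open>s\<^sub>i\<close> has index \<open>n + i\<close>, and \<open>y\<close> has index \<open>n + m + 2\<close>.
\<close>

definition f_form ::
  "nat \<Rightarrow> nat \<Rightarrow> mpoly \<Rightarrow> (nat \<Rightarrow> mpoly) \<Rightarrow> nat \<Rightarrow> real \<Rightarrow> (nat \<Rightarrow> real) \<Rightarrow> real \<Rightarrow> real \<Rightarrow> mpoly" where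
  "f_form n m p g d R \<eta> \<beta> \<gamma> =
    (let s = (\<lambda>i. mp_var (n + i)); y = mp_var (n + m + 2); h = homogenize (2 * d) (n + m + 2) in
      (mp_const \<gamma> * y ^ (2 * d) - h p - s 0 ^ 2 * y ^ (2 * d - 2)) ^ 2
      + (\<Sum>i\<in>{1..m}. (h (g i) - s i ^ 2 * y ^ (2 * d - 2)) ^ 2)
      + (mp_const ((R + (\<Sum>i\<in>{1..m}. \<eta> i) + \<beta> + \<gamma>) ^ d) * y ^ (2 * d)
          - ((\<Sum>i<n. mp_var i ^ 2) + (\<Sum>i\<in>{0..m}. s i ^ 2)) ^ d
          - s (m + 1) ^ (2 * d)) ^ 2)"

text \<open>
  \<open>Pol r N D\<close> is the set \<open>Pol\<^sup>r\<close> for forms of degree \<open>2D\<close> in \<open>N\<close> variables.  Among the \<open>2N\<close> variables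
  \<open>(v, w)\<close>, those of the \<open>v\<close> block have indices \<open>{..<N}\<close> and those of the \<open>w\<close> block \<open>{N..<2N}\<close>.
\<close>

definition Pol :: "nat \<Rightarrow> nat \<Rightarrow> nat \<Rightarrow> mpoly set" where
  "Pol r N D = {q. is_form N (2 * D) q \<and>
    (let v = mp_var; w = (\<lambda>i. mp_var (N + i)) in
      \<forall>a. mp_coeff
        ((mp_subst (\<lambda>i. v i ^ 2 - w i ^ 2) q
            + mp_const (1 / (2 * real r)) * (\<Sum>i<N. v i ^ 4 + w i ^ 4) ^ D)
          * ((\<Sum>i<N. v i ^ 2) + (\<Sum>i<N. w i ^ 2)) ^ (r ^ 2)) a \<ge> 0)}"

text \<open>Suprema are extended-real, so \<open>l_bound\<close> is \<open>-\<infinity>\<close> when no \<open>\<gamma>\<close> qualifies. Here \<open>D = 2d\<close>.\<close>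

definition l_bound ::
  "nat \<Rightarrow> nat \<Rightarrow> mpoly \<Rightarrow> (nat \<Rightarrow> mpoly) \<Rightarrow> nat \<Rightarrow> real \<Rightarrow> (nat \<Rightarrow> real) \<Rightarrow> real \<Rightarrow> nat \<Rightarrow> ereal" where
  "l_bound n m p g d R \<eta> \<beta> r = Sup (ereal ` {\<gamma>.
     f_form n m p g d R \<eta> \<beta> \<gamma>
       - mp_const (1 / real r) * (\<Sum>i<n + m + 3. mp_var i ^ 2) ^ (2 * d)
     \<in> Pol r (n + m + 3) (2 * d)})"

definition m_bound ::
  "nat \<Rightarrow> nat \<Rightarrow> mpoly \<Rightarrow> (nat \<Rightarrow> mpoly) \<Rightarrow> nat \<Rightarrow> real \<Rightarrow> (nat \<Rightarrow> real) \<Rightarrow> real \<Rightarrow> nat \<Rightarrow> ereal" where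
  "m_bound n m p g d R \<eta> \<beta> r = Max (l_bound n m p g d R \<eta> \<beta> ` {1..r})"

end

theory Submission
  imports Defs
begin

text \<open>
  The hierarchy converges because two equivalences fit together.

  The form \<open>f\<^sub>\<gamma>\<close> is a sum of squares whose real zeros with \<open>y = 1\<close> are the feasible points \<open>x\<close>
  with \<open>p(x) \<le> \<gamma>\<close>, completed by slack variables, and which has no nonzero zero with \<open>y = 0\<close>. Hence
  \<open>f\<^sub>\<gamma>\<close> is positive definite if \<open>\<gamma>\<close> is below the optimal value (\<open>f_positive\<close>), and it is not if
  some feasible value is at most \<open>\<gamma>\<close> (\<open>f_zero\<close>).

  Positive definiteness of a form \<open>q\<close> of degree \<open>2D\<close> is, in turn, the same as
  \<open>q - |z|\<^sup>2\<^sup>D / r \<in> Pol\<^sup>r\<close> for some \<open>r\<close>. If \<open>q - |z|\<^sup>2\<^sup>D / r\<close> lies in \<open>Pol\<^sup>r\<close>, then inserting the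
  positive and negative parts of \<open>z\<close> for \<open>v\<^sup>2\<close> and \<open>w\<^sup>2\<close> shows that \<open>q - |z|\<^sup>2\<^sup>D / r\<close> is at least
  \<open>- |z|\<^sup>2\<^sup>D / (2 r)\<close> (\<open>Pol_eval_lower_bound\<close>), so \<open>q\<close> is positive. The converse is
  \<open>positive_form_in_Pol\<close>. In the variables \<open>v\<^sup>2\<close>, \<open>w\<^sup>2\<close>, which range over the nonnegative orthant,
  nonnegativity of the coefficients is the conclusion of Polya's theorem, but the exponent \<open>r\<^sup>2\<close> is
  tied to the perturbation \<open>1 / (2 r)\<close>, so a quantitative version is needed. It comes from the closed
  form of the coefficients: up to a positive factor, the coefficient at \<open>b\<close> of a form of degree \<open>e\<close>
  times the \<open>k\<close>-th power of the sum of the variables is the value of the form at \<open>b / (k + e)\<close>, with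
  an error of order \<open>1 / (k + e)\<close> (\<open>polya_estimate\<close>). For \<open>k = r\<^sup>2\<close> this error is
  of order \<open>1 / r\<^sup>2\<close> and loses against the lower bound of order \<open>1 / r\<close> that the perturbation provides.
\<close>

section \<open>Evaluation and substitution as ring homomorphisms\<close>

definition mono_val :: "(nat \<Rightarrow> 'b::comm_ring_1) \<Rightarrow> (nat \<Rightarrow>\<^sub>0 nat) \<Rightarrow> 'b" where
  "mono_val \<sigma> a = (\<Prod>i\<in>Poly_Mapping.keys a. \<sigma> i ^ Poly_Mapping.lookup a i)"

text \<open>
  Evaluation at a point and substitution of polynomials are the same construction, for two choices
  of the map \<open>h\<close> that embeds the scalars into the target ring.
\<close>

definition mp_hom :: "(real \<Rightarrow> 'b::comm_ring_1) \<Rightarrow> (nat \<Rightarrow> 'b) \<Rightarrow> mpoly \<Rightarrow> 'b" where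
  "mp_hom h \<sigma> p = (\<Sum>a\<in>Poly_Mapping.keys p. h (mp_coeff p a) * mono_val \<sigma> a)"

lemma mono_val_superset:
  assumes "finite I" "Poly_Mapping.keys a \<subseteq> I"
  shows "mono_val \<sigma> a = (\<Prod>i\<in>I. \<sigma> i ^ Poly_Mapping.lookup a i)"
  unfolding mono_val_def using assms
  by (intro prod.mono_neutral_left) (auto simp: in_keys_iff)

lemma mono_val_zero [simp]: "mono_val \<sigma> 0 = 1"
  by (simp add: mono_val_def)

lemma mono_val_single [simp]: "mono_val \<sigma> (Poly_Mapping.single i k) = \<sigma> i ^ k"
  by (simp add: mono_val_def)

lemma mono_val_add: "mono_val \<sigma> (a + b) = mono_val \<sigma> a * mono_val \<sigma> b"
proof -
  let ?I = "Poly_Mapping.keys a \<union> Poly_Mapping.keys b"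
  have "mono_val \<sigma> (a + b) = (\<Prod>i\<in>?I. \<sigma> i ^ Poly_Mapping.lookup (a + b) i)"
    by (intro mono_val_superset) (auto simp: in_keys_iff lookup_add)
  also have "\<dots> = (\<Prod>i\<in>?I. \<sigma> i ^ Poly_Mapping.lookup a i) * (\<Prod>i\<in>?I. \<sigma> i ^ Poly_Mapping.lookup b i)"
    by (simp add: lookup_add power_add prod.distrib)
  also have "\<dots> = mono_val \<sigma> a * mono_val \<sigma> b"
    by (subst (1 2) mono_val_superset[of ?I, symmetric]) auto
  finally show ?thesis .
qed

lemma mpoly_eq_sum_terms:
  "p = (\<Sum>a\<in>Poly_Mapping.keys p. Poly_Mapping.single a (mp_coeff p a))" for p :: mpoly
proof (rule poly_mapping_eqI)
  fix b
  have "Poly_Mapping.lookup (\<Sum>a\<in>Poly_Mapping.keys p. Poly_Mapping.single a (mp_coeff p a)) b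
      = (\<Sum>a\<in>Poly_Mapping.keys p. if a = b then mp_coeff p a else 0)"
    by (auto simp: lookup_sum lookup_single when_def intro!: sum.cong)
  also have "\<dots> = Poly_Mapping.lookup p b"
    by (auto simp: mp_coeff_def in_keys_iff)
  finally show "Poly_Mapping.lookup p b
      = Poly_Mapping.lookup (\<Sum>a\<in>Poly_Mapping.keys p. Poly_Mapping.single a (mp_coeff p a)) b"
    by simp
qed

lemma mpoly_mult_terms:
  "p * q = (\<Sum>a\<in>Poly_Mapping.keys p. \<Sum>b\<in>Poly_Mapping.keys q.
      Poly_Mapping.single (a + b) (mp_coeff p a * mp_coeff q b))" for p q :: mpoly
  by (subst mpoly_eq_sum_terms[of p], subst mpoly_eq_sum_terms[of q])
    (simp add: sum_product mult_single)

locale scalar_hom =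
  fixes h :: "real \<Rightarrow> 'b::comm_ring_1"
  assumes h_add: "h (x + y) = h x + h y"
    and h_mult: "h (x * y) = h x * h y"
    and h_one: "h 1 = 1"
begin

lemma h_zero: "h 0 = 0"
  using h_add[of 0 0] by simp

lemma mp_hom_superset:
  assumes "finite A" "Poly_Mapping.keys p \<subseteq> A"
  shows "mp_hom h \<sigma> p = (\<Sum>a\<in>A. h (mp_coeff p a) * mono_val \<sigma> a)"
  unfolding mp_hom_def using assms
  by (intro sum.mono_neutral_left) (auto simp: in_keys_iff mp_coeff_def h_zero)

lemma mp_hom_add: "mp_hom h \<sigma> (p + q) = mp_hom h \<sigma> p + mp_hom h \<sigma> q"
proof -
  let ?A = "Poly_Mapping.keys p \<union> Poly_Mapping.keys q"
  have "mp_hom h \<sigma> (p + q) = (\<Sum>a\<in>?A. h (mp_coeff (p + q) a) * mono_val \<sigma> a)"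
    by (intro mp_hom_superset) (auto simp: in_keys_iff lookup_add)
  also have "\<dots> = (\<Sum>a\<in>?A. h (mp_coeff p a) * mono_val \<sigma> a) + (\<Sum>a\<in>?A. h (mp_coeff q a) * mono_val \<sigma> a)"
    by (simp add: mp_coeff_def lookup_add h_add sum.distrib algebra_simps)
  also have "\<dots> = mp_hom h \<sigma> p + mp_hom h \<sigma> q"
    by (subst (1 2) mp_hom_superset[of ?A, symmetric]) auto
  finally show ?thesis .
qed

lemma mp_hom_zero [simp]: "mp_hom h \<sigma> 0 = 0"
  by (simp add: mp_hom_def)

lemma mp_hom_uminus: "mp_hom h \<sigma> (- p) = - mp_hom h \<sigma> p"
  using mp_hom_add[of \<sigma> "- p" p] by (simp add: eq_neg_iff_add_eq_0)

lemma mp_hom_diff: "mp_hom h \<sigma> (p - q) = mp_hom h \<sigma> p - mp_hom h \<sigma> q"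
  using mp_hom_add[of \<sigma> p "- q"] by (simp add: mp_hom_uminus)

lemma mp_hom_sum: "mp_hom h \<sigma> (\<Sum>i\<in>I. f i) = (\<Sum>i\<in>I. mp_hom h \<sigma> (f i))"
  by (induction I rule: infinite_finite_induct) (auto simp: mp_hom_add)

lemma mp_hom_single: "mp_hom h \<sigma> (Poly_Mapping.single a c) = h c * mono_val \<sigma> a"
  by (cases "c = 0") (auto simp: mp_hom_def mp_coeff_def h_zero)

lemma mp_hom_mult: "mp_hom h \<sigma> (p * q) = mp_hom h \<sigma> p * mp_hom h \<sigma> q"
  unfolding mpoly_mult_terms[of p q]
    by (simp add: mp_hom_sum mp_hom_single h_mult mono_val_add mp_hom_def[of h \<sigma> p]
        mp_hom_def[of h \<sigma> q] sum_product algebra_simps)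

lemma mp_hom_const: "mp_hom h \<sigma> (mp_const c) = h c"
  by (simp add: mp_const_def mp_hom_single)

lemma mp_hom_one [simp]: "mp_hom h \<sigma> 1 = 1"
  using mp_hom_const[of \<sigma> 1] by (simp add: mp_const_def h_one)

lemma mp_hom_power: "mp_hom h \<sigma> (p ^ k) = mp_hom h \<sigma> p ^ k"
  by (induction k) (auto simp: mp_hom_mult)

lemma mp_hom_var: "mp_hom h \<sigma> (mp_var i) = \<sigma> i"
  by (simp add: mp_var_def mp_hom_single h_one)

end

lemma mp_eval_eq_hom: "mp_eval x = mp_hom (\<lambda>c. c) x"
  by (rule ext) (simp add: mp_eval_def mp_hom_def mono_val_def)

lemma mp_subst_eq_hom: "mp_subst \<sigma> = mp_hom mp_const \<sigma>"
  by (rule ext) (simp add: mp_subst_def mp_hom_def mono_val_def)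

interpretation eval: scalar_hom "\<lambda>c::real. c"
  by unfold_locales auto

interpretation subst: scalar_hom mp_const
  by unfold_locales (auto simp: mp_const_def single_add mult_single)

lemmas mp_eval_simps =
  eval.mp_hom_add[folded mp_eval_eq_hom] eval.mp_hom_diff[folded mp_eval_eq_hom]
  eval.mp_hom_sum[folded mp_eval_eq_hom] eval.mp_hom_mult[folded mp_eval_eq_hom]
  eval.mp_hom_power[folded mp_eval_eq_hom] eval.mp_hom_const[folded mp_eval_eq_hom]
  eval.mp_hom_var[folded mp_eval_eq_hom]

lemmas mp_subst_simps =
  subst.mp_hom_add[folded mp_subst_eq_hom] subst.mp_hom_diff[folded mp_subst_eq_hom]
  subst.mp_hom_sum[folded mp_subst_eq_hom] subst.mp_hom_mult[folded mp_subst_eq_hom]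
  subst.mp_hom_power[folded mp_subst_eq_hom] subst.mp_hom_const[folded mp_subst_eq_hom]
  subst.mp_hom_var[folded mp_subst_eq_hom]

lemma mp_eval_alt: "mp_eval x p = (\<Sum>a\<in>Poly_Mapping.keys p. mp_coeff p a * mono_val x a)"
  by (simp add: mp_eval_def mono_val_def)

lemma mp_subst_alt:
  "mp_subst \<sigma> p = (\<Sum>a\<in>Poly_Mapping.keys p. mp_const (mp_coeff p a) * mono_val \<sigma> a)"
  by (simp add: mp_subst_def mono_val_def)

lemma mp_eval_mono_val: "mp_eval x (mono_val \<sigma> a) = mono_val (\<lambda>i. mp_eval x (\<sigma> i)) a"
proof -
  have "mp_eval x (\<Prod>i\<in>I. f i) = (\<Prod>i\<in>I. mp_eval x (f i))" for I :: "nat set" and f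
    by (induction I rule: infinite_finite_induct)
      (auto simp: mp_eval_simps mp_eval_eq_hom eval.mp_hom_mult)
  then show ?thesis
    by (simp add: mono_val_def mp_eval_simps)
qed

lemma mp_subst_mono_val: "mp_subst \<tau> (mono_val \<sigma> a) = mono_val (\<lambda>i. mp_subst \<tau> (\<sigma> i)) a"
proof -
  have "mp_subst \<tau> (\<Prod>i\<in>I. f i) = (\<Prod>i\<in>I. mp_subst \<tau> (f i))" for I :: "nat set" and f
    by (induction I rule: infinite_finite_induct)
      (auto simp: mp_subst_eq_hom subst.mp_hom_mult)
  then show ?thesis
    by (simp add: mono_val_def mp_subst_simps)
qed

lemma mp_eval_subst: "mp_eval x (mp_subst \<sigma> p) = mp_eval (\<lambda>i. mp_eval x (\<sigma> i)) p"
  by (simp add: mp_subst_alt[of \<sigma>] mp_eval_simps mp_eval_mono_val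
      mp_eval_alt[of "\<lambda>i. mp_eval x (\<sigma> i)"])

lemma mp_subst_subst: "mp_subst \<tau> (mp_subst \<sigma> p) = mp_subst (\<lambda>i. mp_subst \<tau> (\<sigma> i)) p"
  by (simp add: mp_subst_alt[of \<sigma>] mp_subst_simps mp_subst_mono_val
      mp_subst_alt[of "\<lambda>i. mp_subst \<tau> (\<sigma> i)"])

lemma mp_eval_cong:
  assumes "\<And>i. i \<in> mp_vars p \<Longrightarrow> x i = y i"
  shows "mp_eval x p = mp_eval y p"
  unfolding mp_eval_def
proof (rule sum.cong)
  fix a assume "a \<in> Poly_Mapping.keys p"
  then have "x i = y i" if "i \<in> Poly_Mapping.keys a" for i
    using that assms by (auto simp: mp_vars_def)
  then show "mp_coeff p a * (\<Prod>i\<in>Poly_Mapping.keys a. x i ^ Poly_Mapping.lookup a i)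
      = mp_coeff p a * (\<Prod>i\<in>Poly_Mapping.keys a. y i ^ Poly_Mapping.lookup a i)"
    by simp
qed simp

lemma mp_eval_continuous: "continuous_on UNIV (\<lambda>x. mp_eval x p)"
  unfolding mp_eval_def
  by (intro continuous_on_sum continuous_on_mult continuous_on_const continuous_on_prod
      continuous_on_power continuous_on_product_coordinates)

section \<open>Forms\<close>

lemma mono_degree_superset:
  assumes "finite I" "Poly_Mapping.keys a \<subseteq> I"
  shows "mono_degree a = (\<Sum>i\<in>I. Poly_Mapping.lookup a i)"
  unfolding mono_degree_def using assms
  by (intro sum.mono_neutral_left) (auto simp: in_keys_iff)

lemma mono_degree_add: "mono_degree (a + b) = mono_degree a + mono_degree b"
proof -
  let ?I = "Poly_Mapping.keys a \<union> Poly_Mapping.keys b"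
  have "mono_degree (a + b) = (\<Sum>i\<in>?I. Poly_Mapping.lookup (a + b) i)"
    by (intro mono_degree_superset) (auto simp: in_keys_iff lookup_add)
  also have "\<dots> = (\<Sum>i\<in>?I. Poly_Mapping.lookup a i) + (\<Sum>i\<in>?I. Poly_Mapping.lookup b i)"
    by (simp add: lookup_add sum.distrib)
  also have "\<dots> = mono_degree a + mono_degree b"
    by (subst (1 2) mono_degree_superset[of ?I, symmetric]) auto
  finally show ?thesis .
qed

lemma mono_degree_single [simp]: "mono_degree (Poly_Mapping.single i k) = k"
  by (simp add: mono_degree_def)

lemma mono_degree_zero [simp]: "mono_degree 0 = 0"
  by (simp add: mono_degree_def)

lemma is_form_iff:
  "is_form N k q \<longleftrightarrow>
    (\<forall>a\<in>Poly_Mapping.keys q. Poly_Mapping.keys a \<subseteq> {..<N} \<and> mono_degree a = k)"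
  by (auto simp: is_form_def mp_vars_def)

lemma is_form_zero [simp]: "is_form N k 0"
  by (simp add: is_form_iff)

lemma is_form_add: "is_form N k p \<Longrightarrow> is_form N k q \<Longrightarrow> is_form N k (p + q)"
  using keys_add[of p q] by (auto simp: is_form_iff)

lemma is_form_diff: "is_form N k p \<Longrightarrow> is_form N k q \<Longrightarrow> is_form N k (p - q)"
  using keys_diff[of p q] by (auto simp: is_form_iff)

lemma is_form_sum: "(\<And>i. i \<in> I \<Longrightarrow> is_form N k (f i)) \<Longrightarrow> is_form N k (\<Sum>i\<in>I. f i)"
  by (induction I rule: infinite_finite_induct) (auto intro: is_form_add)

lemma is_form_mult:
  assumes "is_form N k p" "is_form N l q"
  shows "is_form N (k + l) (p * q)"
  unfolding is_form_iff
proof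
  fix a assume "a \<in> Poly_Mapping.keys (p * q)"
  then obtain b c where bc: "a = b + c" "b \<in> Poly_Mapping.keys p" "c \<in> Poly_Mapping.keys q"
    using keys_mult[of p q] by blast
  have "Poly_Mapping.keys a \<subseteq> {..<N}"
    using bc assms keys_add[of b c] unfolding is_form_iff by blast
  with bc assms show "Poly_Mapping.keys a \<subseteq> {..<N} \<and> mono_degree a = k + l"
    by (simp add: is_form_iff mono_degree_add)
qed

lemma is_form_const: "is_form N 0 (mp_const c)"
  by (cases "c = 0") (simp_all add: is_form_iff mp_const_def)

lemma is_form_const_mult: "is_form N k p \<Longrightarrow> is_form N k (mp_const c * p)"
  using is_form_mult[of N 0 "mp_const c" k p] is_form_const[of N c] by simp

lemma is_form_var: "i < N \<Longrightarrow> is_form N 1 (mp_var i)"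
  by (auto simp: is_form_iff mp_var_def)

lemma is_form_power: "is_form N k p \<Longrightarrow> is_form N (k * j) (p ^ j)"
proof (induction j)
  case 0
  show ?case using is_form_const[of N 1] by (simp add: mp_const_def)
next
  case (Suc j)
  then show ?case using is_form_mult[of N k p "k * j" "p ^ j"] by simp
qed

lemma is_form_var_power: "i < N \<Longrightarrow> is_form N j (mp_var i ^ j)"
  using is_form_power[OF is_form_var, of i N j] by simp

lemma is_form_homogenize:
  assumes "mp_vars q \<subseteq> {..<N}" "y < N" "mp_degree q \<le> k"
  shows "is_form N k (homogenize k y q)"
  unfolding homogenize_def
proof (rule is_form_sum)
  fix a assume a: "a \<in> Poly_Mapping.keys q"
  then have "mono_degree a \<le> k"
    using assms(3) by (auto simp: mp_degree_def)
  moreover have "Poly_Mapping.keys a \<subseteq> {..<N}"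
    using a assms(1) by (auto simp: mp_vars_def)
  moreover have "Poly_Mapping.keys (a + Poly_Mapping.single y (k - mono_degree a))
      \<subseteq> Poly_Mapping.keys a \<union> {y}"
    using keys_add[of a "Poly_Mapping.single y (k - mono_degree a)"] by (auto split: if_splits)
  ultimately show "is_form N k
      (Poly_Mapping.single (a + Poly_Mapping.single y (k - mono_degree a)) (mp_coeff q a))"
    using assms(2) by (auto simp: is_form_iff mono_degree_add)
qed

lemma mp_eval_homogenize:
  assumes "z y = 1"
  shows "mp_eval z (homogenize k y q) = mp_eval z q"
proof -
  have "mp_eval z (homogenize k y q)
      = (\<Sum>a\<in>Poly_Mapping.keys q. mp_coeff q a * mono_val z a)"
    unfolding homogenize_def mp_eval_eq_hom eval.mp_hom_sum eval.mp_hom_single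
    by (simp add: mono_val_add assms)
  then show ?thesis by (simp add: mp_eval_alt)
qed

lemma mp_eval_form_scale:
  assumes "is_form N k q"
  shows "mp_eval (\<lambda>i. c * x i) q = c ^ k * mp_eval x q"
  unfolding mp_eval_alt sum_distrib_left
proof (rule sum.cong)
  fix a assume "a \<in> Poly_Mapping.keys q"
  then have "mono_degree a = k" using assms by (simp add: is_form_iff)
  then show "mp_coeff q a * mono_val (\<lambda>i. c * x i) a = c ^ k * (mp_coeff q a * mono_val x a)"
    by (auto simp: mono_val_def mono_degree_def power_mult_distrib prod.distrib power_sum)
qed simp

lemma mp_eval_form_cong:
  assumes "is_form N k q" "\<And>i. i < N \<Longrightarrow> x i = y i"
  shows "mp_eval x q = mp_eval y q"
  using assms by (intro mp_eval_cong) (auto simp: is_form_def)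

lemma is_form_subst:
  assumes "is_form N k q" "\<And>i. i < N \<Longrightarrow> is_form M 1 (\<sigma> i)"
  shows "is_form M k (mp_subst \<sigma> q)"
  unfolding mp_subst_alt
proof (rule is_form_sum)
  fix a assume a: "a \<in> Poly_Mapping.keys q"
  have "is_form M (\<Sum>i\<in>I. e i) (\<Prod>i\<in>I. \<sigma> i ^ e i)" if "I \<subseteq> {..<N}" "finite I" for I e
    using that(2,1)
  proof (induction I rule: finite_induct)
    case empty
    show ?case using is_form_const[of M 1] by (simp add: mp_const_def)
  next
    case (insert i I)
    then show ?case
      using is_form_mult[of M "e i" "\<sigma> i ^ e i"] is_form_power[OF assms(2), of i "e i"] by auto
  qed
  from this[of "Poly_Mapping.keys a" "Poly_Mapping.lookup a"]
  have "is_form M k (mono_val \<sigma> a)"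
    using a assms(1) by (auto simp: is_form_iff mono_val_def mono_degree_def)
  then show "is_form M k (mp_const (mp_coeff q a) * mono_val \<sigma> a)"
    by (rule is_form_const_mult)
qed

section \<open>Polynomials with nonnegative coefficients\<close>

definition nonneg_coeffs :: "mpoly \<Rightarrow> bool" where
  "nonneg_coeffs p \<longleftrightarrow> (\<forall>a. mp_coeff p a \<ge> 0)"

lemma nonneg_coeffs_sum:
  "(\<And>i. i \<in> I \<Longrightarrow> nonneg_coeffs (f i)) \<Longrightarrow> nonneg_coeffs (\<Sum>i\<in>I. f i)"
  by (auto simp: nonneg_coeffs_def mp_coeff_def lookup_sum intro!: sum_nonneg)

lemma nonneg_coeffs_single: "c \<ge> 0 \<Longrightarrow> nonneg_coeffs (Poly_Mapping.single a c)"
  by (simp add: nonneg_coeffs_def mp_coeff_def lookup_single when_def)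

lemma nonneg_coeffs_mult:
  assumes "nonneg_coeffs p" "nonneg_coeffs q"
  shows "nonneg_coeffs (p * q)"
  unfolding mpoly_mult_terms[of p q]
  by (intro nonneg_coeffs_sum nonneg_coeffs_single mult_nonneg_nonneg)
    (use assms in \<open>auto simp: nonneg_coeffs_def\<close>)

lemma nonneg_coeffs_subst:
  assumes "nonneg_coeffs p" "\<And>i. nonneg_coeffs (\<sigma> i)"
  shows "nonneg_coeffs (mp_subst \<sigma> p)"
proof -
  have const: "nonneg_coeffs (mp_const c)" if "c \<ge> 0" for c
    using that by (simp add: mp_const_def nonneg_coeffs_single)
  have one: "nonneg_coeffs 1"
    using const[of 1] by (simp add: mp_const_def)
  have pow: "nonneg_coeffs (\<sigma> i ^ k)" for i k
    by (induction k) (auto intro: one nonneg_coeffs_mult assms(2))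
  have "nonneg_coeffs (\<Prod>i\<in>I. \<sigma> i ^ e i)" for I :: "nat set" and e
    by (induction I rule: infinite_finite_induct) (auto intro: one nonneg_coeffs_mult pow)
  then show ?thesis
    using assms(1) unfolding mp_subst_def
    by (intro nonneg_coeffs_sum nonneg_coeffs_mult const) (auto simp: nonneg_coeffs_def)
qed

text \<open>
  All certificates in \<open>Pol\<close> rest on this elementary fact about the nonnegative orthant; the squares
  of the variables are what brings an arbitrary point into it.
\<close>

lemma nonneg_coeffs_eval_nonneg:
  assumes "nonneg_coeffs p" "\<And>i. x i \<ge> 0"
  shows "mp_eval x p \<ge> 0"
  using assms unfolding mp_eval_def nonneg_coeffs_def
  by (intro sum_nonneg mult_nonneg_nonneg prod_nonneg) auto

section \<open>Polya's theorem with a bound on the exponent\<close>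

definition var_sum :: "nat \<Rightarrow> mpoly" where
  "var_sum M = (\<Sum>i<M. mp_var i)"

text \<open>
  With \<open>mfact M b = b!\<close> and \<open>falling M b a\<close> the product of the falling factorials of \<open>b\<^sub>i\<close> of length
  \<open>a\<^sub>i\<close>, the coefficients in Polya's theorem have a closed form. The truncating subtraction in
  \<open>falling\<close> gives the falling factorial its right value \<open>0\<close> when \<open>a\<^sub>i > b\<^sub>i\<close>, and keeps every factor
  between \<open>0\<close> and \<open>b\<^sub>i\<close>.
\<close>

definition mfact :: "nat \<Rightarrow> (nat \<Rightarrow>\<^sub>0 nat) \<Rightarrow> real" where
  "mfact M b = (\<Prod>i<M. fact (Poly_Mapping.lookup b i))"

definition falling :: "nat \<Rightarrow> (nat \<Rightarrow>\<^sub>0 nat) \<Rightarrow> (nat \<Rightarrow>\<^sub>0 nat) \<Rightarrow> real" where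
  "falling M b a = (\<Prod>i<M. \<Prod>j<Poly_Mapping.lookup a i. real (Poly_Mapping.lookup b i - j))"

lemma mfact_pos: "mfact M b > 0"
  by (simp add: mfact_def prod_pos)

lemma fact_eq_falling: "fact (s + t) = fact s * (\<Prod>j<t. real (s + t - j))"
proof (induction t arbitrary: s)
  case (Suc t)
  have "fact (s + Suc t) = fact (Suc s + t)" by simp
  also have "\<dots> = fact (Suc s) * (\<Prod>j<t. real (Suc s + t - j))" by (rule Suc.IH)
  also have "\<dots> = fact s * (\<Prod>j<Suc t. real (s + Suc t - j))"
    by (simp add: algebra_simps)
  finally show ?case .
qed simp

lemma mfact_add: "mfact M (a + b) = mfact M b * falling M (a + b) a"
  unfolding mfact_def falling_def prod.distrib[symmetric] lookup_add
  by (intro prod.cong refl) (metis add.commute fact_eq_falling)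

lemma falling_eq_0:
  assumes "i < M" "Poly_Mapping.lookup b i < Poly_Mapping.lookup a i"
  shows "falling M b a = 0"
proof -
  have "(\<Prod>j<Poly_Mapping.lookup a i. real (Poly_Mapping.lookup b i - j)) = 0"
    using assms(2) by (intro prod_zero) auto
  with assms(1) show ?thesis
    unfolding falling_def by (intro prod_zero) auto
qed

lemma exponent_diff:
  fixes a b :: "nat \<Rightarrow>\<^sub>0 nat"
  assumes "Poly_Mapping.keys a \<subseteq> {..<M}"
    and "\<And>i. i < M \<Longrightarrow> Poly_Mapping.lookup a i \<le> Poly_Mapping.lookup b i"
  shows "b = a + (b - a)"
proof (rule poly_mapping_eqI)
  fix i
  have "Poly_Mapping.lookup a i \<le> Poly_Mapping.lookup b i"
  proof (cases "i < M")
    case False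
    then have "i \<notin> Poly_Mapping.keys a" using assms(1) by auto
    then show ?thesis by (simp add: in_keys_iff)
  qed (rule assms(2))
  then show "Poly_Mapping.lookup b i = Poly_Mapping.lookup (a + (b - a)) i"
    by (simp add: lookup_add lookup_minus)
qed

lemma coeff_single_mult:
  "mp_coeff (Poly_Mapping.single a c * p) b
    = (\<Sum>b'\<in>Poly_Mapping.keys p. if a + b' = b then c * mp_coeff p b' else 0)"
proof (cases "c = 0")
  case False
  then show ?thesis
    unfolding mpoly_mult_terms[of "Poly_Mapping.single a c" p]
    by (auto simp: mp_coeff_def lookup_sum lookup_single when_def intro!: sum.cong)
qed (simp add: mp_coeff_def sum.neutral)

lemma coeff_single_mult_add: "mp_coeff (Poly_Mapping.single a c * p) (a + b) = c * mp_coeff p b"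
  by (simp add: coeff_single_mult) (auto simp: mp_coeff_def in_keys_iff)

lemma coeff_single_mult_eq_0:
  assumes "\<And>b'. b \<noteq> a + b'"
  shows "mp_coeff (Poly_Mapping.single a c * p) b = 0"
  unfolding coeff_single_mult using assms[symmetric] by simp

lemma coeff_sum: "mp_coeff (\<Sum>i\<in>I. f i) b = (\<Sum>i\<in>I. mp_coeff (f i) b)"
  by (simp add: mp_coeff_def lookup_sum)

text \<open>
  The multinomial theorem. The induction splits off one factor of the power: removing one
  occurrence of \<open>x\<^sub>i\<close> from \<open>b\<close> multiplies \<open>1 / b!\<close> by \<open>b\<^sub>i\<close>, and the \<open>b\<^sub>i\<close> add up to the degree.
\<close>

lemma coeff_var_sum_power:
  assumes "Poly_Mapping.keys b \<subseteq> {..<M}" "mono_degree b = k"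
  shows "mp_coeff (var_sum M ^ k) b = fact k / mfact M b"
  using assms
proof (induction k arbitrary: b)
  case 0
  then have "b = 0"
    by (auto intro!: poly_mapping_eqI simp: mono_degree_def in_keys_iff)
  then show ?case by (simp add: mp_coeff_def mfact_def)
next
  case (Suc k)
  have "mp_coeff (mp_var i * var_sum M ^ k) b
      = real (Poly_Mapping.lookup b i) * (fact k / mfact M b)" if i: "i < M" for i
  proof (cases "Poly_Mapping.lookup b i = 0")
    case True
    have "b \<noteq> Poly_Mapping.single i 1 + b'" for b'
    proof
      assume "b = Poly_Mapping.single i 1 + b'"
      with True show False by (simp add: lookup_add)
    qed
    with True show ?thesis by (simp add: mp_var_def coeff_single_mult_eq_0)
  next
    case False
    define b' where "b' = b - Poly_Mapping.single i 1"
    have b: "b = Poly_Mapping.single i 1 + b'"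
      unfolding b'_def using i False
      by (intro exponent_diff[of _ M]) (auto simp: lookup_single when_def)
    have "Poly_Mapping.keys b' \<subseteq> Poly_Mapping.keys b"
      unfolding b by (auto simp: in_keys_iff lookup_add)
    moreover have "mono_degree b' = k"
      using Suc.prems(2) unfolding b by (simp add: mono_degree_add)
    ultimately have IH: "mp_coeff (var_sum M ^ k) b' = fact k / mfact M b'"
      using Suc by blast
    have "falling M b (Poly_Mapping.single i 1)
        = (\<Prod>j<M. if j = i then real (Poly_Mapping.lookup b i) else 1)"
      unfolding falling_def by (intro prod.cong) (auto simp: lookup_single when_def)
    then have "falling M b (Poly_Mapping.single i 1) = real (Poly_Mapping.lookup b i)"
      using i by simp
    then have "mfact M b = mfact M b' * real (Poly_Mapping.lookup b i)"
      using mfact_add[of M "Poly_Mapping.single i 1" b'] b by simp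
    then show ?thesis
      using IH False mfact_pos[of M b']
      by (subst b) (simp add: mp_var_def coeff_single_mult_add)
  qed
  then have "mp_coeff (var_sum M ^ Suc k) b
      = (\<Sum>i<M. real (Poly_Mapping.lookup b i) * (fact k / mfact M b))"
    by (simp add: var_sum_def sum_distrib_right coeff_sum del: times_divide_eq_right)
  also have "\<dots> = real (Suc k) * (fact k / mfact M b)"
    unfolding sum_distrib_right[symmetric] of_nat_sum[symmetric]
    using Suc.prems mono_degree_superset[of "{..<M}" b] by simp
  finally show ?case by simp
qed

text \<open>
  By linearity this is the multinomial theorem for the exponents \<open>b - a\<close>, since
  \<open>b! / (b - a)!\<close> is a product of falling factorials. The sum on the right is what remains of the
  value of \<open>F\<close> at \<open>b\<close> after powers have become falling factorials.
\<close>

lemma coeff_form_times_power: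
  assumes F: "is_form M e F"
    and b: "Poly_Mapping.keys b \<subseteq> {..<M}" "mono_degree b = k + e"
  shows "mp_coeff (F * var_sum M ^ k) b
    = fact k / mfact M b * (\<Sum>a\<in>Poly_Mapping.keys F. mp_coeff F a * falling M b a)"
proof -
  have term_coeff: "mp_coeff (Poly_Mapping.single a (mp_coeff F a) * var_sum M ^ k) b
      = fact k / mfact M b * (mp_coeff F a * falling M b a)"
    if a: "a \<in> Poly_Mapping.keys F" for a
  proof (cases "\<exists>b'. b = a + b'")
    case True
    then obtain b' where b': "b = a + b'" by blast
    have "Poly_Mapping.keys b' \<subseteq> {..<M}"
      using b(1) unfolding b' by (force simp: in_keys_iff lookup_add subset_iff)
    moreover have "mono_degree b' = k"
      using b(2) a F unfolding b' by (simp add: mono_degree_add is_form_iff)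
    ultimately have "mp_coeff (var_sum M ^ k) b' = fact k / mfact M b'"
      by (rule coeff_var_sum_power)
    moreover have "mfact M b = mfact M b' * falling M b a"
      using mfact_add[of M a b'] b' by simp
    moreover have "mp_coeff (Poly_Mapping.single a (mp_coeff F a) * var_sum M ^ k) b
        = mp_coeff F a * mp_coeff (var_sum M ^ k) b'"
      unfolding b' by (rule coeff_single_mult_add)
    ultimately show ?thesis
      using mfact_pos[of M b] mfact_pos[of M b'] by (auto simp: field_simps)
  next
    case False
    have "\<exists>i<M. Poly_Mapping.lookup b i < Poly_Mapping.lookup a i"
    proof (rule ccontr)
      assume "\<not> ?thesis"
      then have "Poly_Mapping.lookup a i \<le> Poly_Mapping.lookup b i" if "i < M" for i
        using that by (meson not_less)
      then have "b = a + (b - a)"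
        using a F by (intro exponent_diff[of _ M]) (simp_all add: is_form_iff)
      with False show False by blast
    qed
    then have "falling M b a = 0" using falling_eq_0 by blast
    with False show ?thesis by (simp add: coeff_single_mult_eq_0)
  qed
  have "F * var_sum M ^ k
      = (\<Sum>a\<in>Poly_Mapping.keys F. Poly_Mapping.single a (mp_coeff F a) * var_sum M ^ k)"
    by (subst mpoly_eq_sum_terms[of F]) (simp add: sum_distrib_right)
  then show ?thesis
    by (simp only: coeff_sum sum_distrib_left term_coeff cong: sum.cong)
qed

lemma lookup_le_mono_degree: "Poly_Mapping.lookup b i \<le> mono_degree b"
  unfolding mono_degree_def
  by (cases "i \<in> Poly_Mapping.keys b") (auto intro!: member_le_sum simp: in_keys_iff)

text \<open>
  Divided by \<open>K\<close>, the factors \<open>b\<^sub>i - j\<close> of the falling factorials and the factors \<open>b\<^sub>i\<close> of the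
  power all lie in \<open>[0, 1]\<close>, and they differ by at most \<open>e / K\<close>. A product of \<open>e\<close> numbers from
  \<open>[0, 1]\<close> changes by at most the sum of the changes of its factors.
\<close>

lemma falling_approx:
  assumes a: "Poly_Mapping.keys a \<subseteq> {..<M}" "mono_degree a = e"
    and b: "mono_degree b = K" "K > 0"
  shows "\<bar>falling M b a / real K ^ e - mono_val (\<lambda>i. real (Poly_Mapping.lookup b i) / real K) a\<bar>
    \<le> real (e * e) / real K"
proof -
  let ?I = "SIGMA i:{..<M}. {..<Poly_Mapping.lookup a i}"
  let ?u = "\<lambda>(i, j). real (Poly_Mapping.lookup b i - j) / real K"
  let ?t = "\<lambda>(i, j). real (Poly_Mapping.lookup b i) / real K"
  have card: "card ?I = e"
    using a mono_degree_superset[of "{..<M}" a] by simp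
  have le: "Poly_Mapping.lookup a i \<le> e" "Poly_Mapping.lookup b i \<le> K" for i
    using lookup_le_mono_degree a b by metis+
  have "mono_val (\<lambda>i. real (Poly_Mapping.lookup b i) / real K) a = prod ?t ?I"
    using a(1) by (subst prod.Sigma[symmetric]) (auto simp: mono_val_superset[of "{..<M}"])
  moreover have "falling M b a / real K ^ e = prod ?u ?I"
  proof -
    have "falling M b a = (\<Prod>(i, j)\<in>?I. real (Poly_Mapping.lookup b i - j))"
      unfolding falling_def by (subst prod.Sigma) auto
    then show ?thesis
      using card by (simp add: prod_dividef case_prod_unfold del: card_SigmaI)
  qed
  moreover have "\<bar>prod ?u ?I - prod ?t ?I\<bar> \<le> (\<Sum>x\<in>?I. \<bar>?u x - ?t x\<bar>)"
  proof (rule norm_prod_diff[of ?I ?u ?t, unfolded real_norm_def])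
    fix x assume "x \<in> ?I"
    obtain i j where x: "x = (i, j)" by fastforce
    show "\<bar>?u x\<bar> \<le> 1" "\<bar>?t x\<bar> \<le> 1"
      using le(2)[of i] b(2) by (auto simp: x divide_le_eq_1)
  qed
  moreover have "(\<Sum>x\<in>?I. \<bar>?u x - ?t x\<bar>) \<le> (\<Sum>x\<in>?I. real e / real K)"
  proof (rule sum_mono)
    fix x assume "x \<in> ?I"
    then obtain i j where x: "x = (i, j)" "j < Poly_Mapping.lookup a i" by auto
    have "\<bar>real (Poly_Mapping.lookup b i - j) - real (Poly_Mapping.lookup b i)\<bar> \<le> real e"
      using x le(1)[of i] by (auto simp: abs_if of_nat_diff)
    then have "\<bar>(real (Poly_Mapping.lookup b i - j) - real (Poly_Mapping.lookup b i)) / real K\<bar>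
        \<le> real e / real K"
      by (simp add: divide_right_mono)
    then show "\<bar>?u x - ?t x\<bar> \<le> real e / real K"
      by (simp add: x diff_divide_distrib)
  qed
  ultimately show ?thesis using card by simp
qed

text \<open>
  After a positive rescaling, the coefficients of \<open>F\<close> times the \<open>k\<close>-th power of the sum of the
  variables are the values of \<open>F\<close> at the points \<open>b / (k + e)\<close> of the simplex, up to an error that
  is inversely proportional to \<open>k + e\<close>. The constant depends on \<open>F\<close> alone, so that the estimate can
  be applied to a family of forms that is linear in a parameter.
\<close>

lemma polya_estimate:
  assumes F: "is_form M e F"
  obtains C where "C \<ge> 0" "\<And>k b. Poly_Mapping.keys b \<subseteq> {..<M} \<Longrightarrow> mono_degree b = k + e \<Longrightarrow> k + e > 0 \<Longrightarrow>
    \<bar>mp_coeff (F * var_sum M ^ k) b * (mfact M b / (fact k * real (k + e) ^ e))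
      - mp_eval (\<lambda>i. real (Poly_Mapping.lookup b i) / real (k + e)) F\<bar> \<le> C / real (k + e)"
proof
  let ?C = "(\<Sum>a\<in>Poly_Mapping.keys F. \<bar>mp_coeff F a\<bar> * real (e * e))"
  show "?C \<ge> 0" by (intro sum_nonneg) auto
  fix k b
  assume b: "Poly_Mapping.keys b \<subseteq> {..<M}" "mono_degree b = k + e" and K: "k + e > 0"
  let ?K = "real (k + e)"
  let ?y = "\<lambda>i. real (Poly_Mapping.lookup b i) / ?K"
  have "mp_coeff (F * var_sum M ^ k) b * (mfact M b / (fact k * ?K ^ e))
      = (\<Sum>a\<in>Poly_Mapping.keys F. mp_coeff F a * falling M b a) / ?K ^ e"
    using mfact_pos[of M b] by (simp add: coeff_form_times_power[OF F b])
  then have "mp_coeff (F * var_sum M ^ k) b * (mfact M b / (fact k * ?K ^ e)) - mp_eval ?y F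
      = (\<Sum>a\<in>Poly_Mapping.keys F. mp_coeff F a * (falling M b a / ?K ^ e - mono_val ?y a))"
    by (simp add: mp_eval_alt sum_divide_distrib sum_subtractf right_diff_distrib)
  also have "\<bar>\<dots>\<bar> \<le> (\<Sum>a\<in>Poly_Mapping.keys F. \<bar>mp_coeff F a\<bar> * (real (e * e) / ?K))"
  proof (rule order_trans[OF sum_abs sum_mono])
    fix a assume "a \<in> Poly_Mapping.keys F"
    then have "\<bar>falling M b a / ?K ^ e - mono_val ?y a\<bar> \<le> real (e * e) / ?K"
      using F b K by (intro falling_approx) (auto simp: is_form_iff)
    then show "\<bar>mp_coeff F a * (falling M b a / ?K ^ e - mono_val ?y a)\<bar>
        \<le> \<bar>mp_coeff F a\<bar> * (real (e * e) / ?K)"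
      unfolding abs_mult by (rule mult_left_mono) simp
  qed
  also have "\<dots> = ?C / ?K"
    by (simp add: sum_divide_distrib)
  finally show "\<bar>mp_coeff (F * var_sum M ^ k) b * (mfact M b / (fact k * ?K ^ e)) - mp_eval ?y F\<bar>
      \<le> ?C / ?K" .
qed

lemma is_form_var_sum: "is_form M 1 (var_sum M)"
  unfolding var_sum_def by (intro is_form_sum is_form_var) auto

text \<open>
  On the simplex the forms are bounded below by \<open>c / r\<close>, which tends to \<open>0\<close>, whereas the error in
  \<open>polya_estimate\<close> with \<open>k = r\<^sup>2\<close> is of order \<open>1 / r\<^sup>2\<close> uniformly in \<open>r\<close>. This is why an exponent
  that grows faster than \<open>r\<close> suffices.
\<close>

lemma polya_quadratic_exponent:
  fixes c :: real
  assumes A: "is_form M e A" and B: "is_form M e B" and c: "c > 0"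
    and pos: "\<And>r x. r \<ge> r0 \<Longrightarrow> (\<And>i. x i \<ge> 0) \<Longrightarrow> (\<Sum>i<M. x i) = 1
      \<Longrightarrow> mp_eval x (A + mp_const (1 / real r) * B) \<ge> c / real r"
  obtains r1 where "r1 \<ge> 1"
    "\<And>r. r \<ge> r1 \<Longrightarrow> nonneg_coeffs ((A + mp_const (1 / real r) * B) * var_sum M ^ r\<^sup>2)"
proof -
  obtain CA where CA: "CA \<ge> 0"
    "\<And>k b. Poly_Mapping.keys b \<subseteq> {..<M} \<Longrightarrow> mono_degree b = k + e \<Longrightarrow> k + e > 0 \<Longrightarrow>
    \<bar>mp_coeff (A * var_sum M ^ k) b * (mfact M b / (fact k * real (k + e) ^ e))
      - mp_eval (\<lambda>i. real (Poly_Mapping.lookup b i) / real (k + e)) A\<bar> \<le> CA / real (k + e)"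
    using polya_estimate[OF A] by blast
  obtain CB where CB: "CB \<ge> 0"
    "\<And>k b. Poly_Mapping.keys b \<subseteq> {..<M} \<Longrightarrow> mono_degree b = k + e \<Longrightarrow> k + e > 0 \<Longrightarrow>
    \<bar>mp_coeff (B * var_sum M ^ k) b * (mfact M b / (fact k * real (k + e) ^ e))
      - mp_eval (\<lambda>i. real (Poly_Mapping.lookup b i) / real (k + e)) B\<bar> \<le> CB / real (k + e)"
    using polya_estimate[OF B] by blast
  define r1 where "r1 = max (max 1 r0) (nat \<lceil>(CA + CB) / c\<rceil>)"
  show ?thesis
  proof
    show "r1 \<ge> 1" by (simp add: r1_def)
    fix r assume r: "r \<ge> r1"
    then have r_ge: "r \<ge> 1" "r \<ge> r0" by (simp_all add: r1_def)
    have "(CA + CB) / c \<le> real (nat \<lceil>(CA + CB) / c\<rceil>)" by (rule real_nat_ceiling_ge)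
    also have "\<dots> \<le> real r" using r by (simp add: r1_def)
    finally have "CA + CB \<le> c * real r" using c by (simp add: divide_le_eq mult.commute)
    let ?F = "A + mp_const (1 / real r) * B"
    have F: "is_form M e ?F"
      by (intro is_form_add is_form_const_mult A B)
    show "nonneg_coeffs (?F * var_sum M ^ r\<^sup>2)"
      unfolding nonneg_coeffs_def
    proof
      fix b
      show "mp_coeff (?F * var_sum M ^ r\<^sup>2) b \<ge> 0"
      proof (cases "b \<in> Poly_Mapping.keys (?F * var_sum M ^ r\<^sup>2)")
        case False
        then show ?thesis by (simp add: mp_coeff_def in_keys_iff)
      next
        case True
        have "is_form M (e + 1 * r\<^sup>2) (?F * var_sum M ^ r\<^sup>2)"
          by (intro is_form_mult is_form_power F is_form_var_sum)
        with True have b: "Poly_Mapping.keys b \<subseteq> {..<M}" "mono_degree b = r\<^sup>2 + e"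
          by (auto simp: is_form_iff)
        define K where "K = real (r\<^sup>2 + e)"
        have K: "K > 0" "K \<ge> real r * real r" "r\<^sup>2 + e > 0"
          using r_ge by (auto simp: K_def power2_eq_square intro: add_pos_nonneg)
        define y where "y = (\<lambda>i. real (Poly_Mapping.lookup b i) / K)"
        \<comment> \<open>the positive factor by which \<open>polya_estimate\<close> rescales the coefficient at \<open>b\<close>\<close>
        define s where "s = mfact M b / (fact (r\<^sup>2) * K ^ e)"
        have s: "s > 0" using mfact_pos[of M b] K by (simp add: s_def)
        have "(\<Sum>i<M. real (Poly_Mapping.lookup b i)) = K"
          using b mono_degree_superset[of "{..<M}" b] by (simp add: K_def flip: of_nat_sum of_nat_add)
        then have "(\<Sum>i<M. y i) = 1"
          using K by (simp add: y_def flip: sum_divide_distrib)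
        then have eval: "c / real r \<le> mp_eval y A + mp_eval y B / real r"
          using pos[of r y] r_ge K by (simp add: y_def mp_eval_simps)
        have estA: "\<bar>mp_coeff (A * var_sum M ^ r\<^sup>2) b * s - mp_eval y A\<bar> \<le> CA / K"
          using CA(2)[OF b K(3)] by (simp only: s_def y_def K_def)
        have estB: "\<bar>mp_coeff (B * var_sum M ^ r\<^sup>2) b * s - mp_eval y B\<bar> \<le> CB / K"
          using CB(2)[OF b K(3)] by (simp only: s_def y_def K_def)
        have expand: "mp_coeff (?F * var_sum M ^ r\<^sup>2) b
            = mp_coeff (A * var_sum M ^ r\<^sup>2) b + mp_coeff (B * var_sum M ^ r\<^sup>2) b / real r"
          using coeff_single_mult_add[of 0 "1 / real r" "B * var_sum M ^ r\<^sup>2" b]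
          by (simp add: distrib_right mult.assoc mp_const_def mp_coeff_def lookup_add)
        have "(CA + CB) / K \<le> c * real r / (real r * real r)"
          using \<open>CA + CB \<le> c * real r\<close> CA(1) CB(1) K r_ge by (intro frac_le) auto
        also have "\<dots> = c / real r" using r_ge by simp
        finally have small: "(CA + CB) / K \<le> c / real r" .
        have "mp_eval y B - CB / K \<le> mp_coeff (B * var_sum M ^ r\<^sup>2) b * s"
          using estB by linarith
        then have "(mp_eval y B - CB / K) / real r \<le> mp_coeff (B * var_sum M ^ r\<^sup>2) b * s / real r"
          by (rule divide_right_mono) simp
        moreover have "CB / K / real r \<le> CB / K"
        proof -
          have "CB / K / real r \<le> CB / K / 1"
            using CB(1) K r_ge by (intro divide_left_mono) auto
          then show ?thesis by simp
        qed
        ultimately have "0 \<le> mp_coeff (?F * var_sum M ^ r\<^sup>2) b * s"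
          using estA eval small unfolding expand
          by (simp add: distrib_right diff_divide_distrib add_divide_distrib)
        with s show ?thesis by (simp add: zero_le_mult_iff)
      qed
    qed
  qed
qed

section \<open>The set \<open>Pol\<close> and positive definite forms\<close>

text \<open>
  The polynomial in the definition of \<open>Pol\<close> is even in every variable; it arises from the one
  below by replacing each variable by its square.
\<close>

definition Pol_numerator :: "nat \<Rightarrow> nat \<Rightarrow> nat \<Rightarrow> mpoly \<Rightarrow> mpoly" where
  "Pol_numerator r N D q = mp_subst (\<lambda>i. mp_var i - mp_var (N + i)) q
    + mp_const (1 / (2 * real r)) * (\<Sum>i<N. mp_var i ^ 2 + mp_var (N + i) ^ 2) ^ D"

lemma sum_lessThan_add: "(\<Sum>i<N + k. f i) = (\<Sum>i<N. f i) + (\<Sum>i<k. f (N + i))"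
  for f :: "nat \<Rightarrow> 'a::comm_monoid_add"
  by (induction k) (simp_all add: add.assoc)

lemma Pol_iff:
  "q \<in> Pol r N D \<longleftrightarrow> is_form N (2 * D) q \<and>
    nonneg_coeffs (mp_subst (\<lambda>i. mp_var i ^ 2) (Pol_numerator r N D q * var_sum (N + N) ^ r\<^sup>2))"
proof -
  have "mp_subst (\<lambda>i. mp_var i ^ 2) (Pol_numerator r N D q * var_sum (N + N) ^ r\<^sup>2)
    = (mp_subst (\<lambda>i. mp_var i ^ 2 - mp_var (N + i) ^ 2) q
      + mp_const (1 / (2 * real r)) * (\<Sum>i<N. mp_var i ^ 4 + mp_var (N + i) ^ 4) ^ D)
      * ((\<Sum>i<N. mp_var i ^ 2) + (\<Sum>i<N. mp_var (N + i) ^ 2)) ^ (r ^ 2)"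
    by (simp add: Pol_numerator_def var_sum_def mp_subst_simps mp_subst_subst sum_lessThan_add
        flip: power_mult)
  then show ?thesis
    by (simp add: Pol_def nonneg_coeffs_def)
qed

lemma mp_eval_Pol_numerator:
  "mp_eval x (Pol_numerator r N D q) = mp_eval (\<lambda>i. x i - x (N + i)) q
    + 1 / (2 * real r) * (\<Sum>i<N. x i ^ 2 + x (N + i) ^ 2) ^ D"
  by (simp add: Pol_numerator_def mp_eval_simps mp_eval_subst)

text \<open>
  Every point is a difference \<open>z = v\<^sup>2 - w\<^sup>2\<close> of vectors of squares. If \<open>v\<^sup>2\<close> and \<open>w\<^sup>2\<close> are chosen as
  the positive and the negative part of \<open>z\<close>, then \<open>v\<^sup>4 + w\<^sup>4 = z\<^sup>2\<close>, so the perturbation in \<open>Pol\<close>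
  becomes the term \<open>1 / (2 r)\<close> times a power of the squared norm of \<open>z\<close>. The multiplier is positive at a nonzero
  point and can be cancelled.
\<close>

lemma Pol_eval_lower_bound:
  assumes q: "q \<in> Pol r N D" and i: "i < N" "z i \<noteq> 0"
  shows "mp_eval z q + 1 / (2 * real r) * (\<Sum>i<N. z i ^ 2) ^ D \<ge> 0"
proof -
  \<comment> \<open>the values of \<open>v\<^sup>2\<close> and \<open>w\<^sup>2\<close>\<close>
  define x where "x = (\<lambda>j. if j < N then max (z j) 0 else max (- z (j - N)) 0)"
  have x_nonneg: "x j \<ge> 0" for j by (simp add: x_def)
  have "mp_eval (\<lambda>j. sqrt (x j)) (mp_subst (\<lambda>i. mp_var i ^ 2)
      (Pol_numerator r N D q * var_sum (N + N) ^ r\<^sup>2)) \<ge> 0"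
    using q x_nonneg by (intro nonneg_coeffs_eval_nonneg) (simp_all add: Pol_iff)
  then have "mp_eval x (Pol_numerator r N D q) * (\<Sum>i<N + N. x i) ^ r\<^sup>2 \<ge> 0"
    using x_nonneg by (simp add: mp_eval_subst mp_eval_simps var_sum_def)
  moreover have "(\<Sum>i<N + N. x i) > 0"
  proof -
    have "0 < \<bar>z i\<bar>" using i by simp
    also have "\<dots> \<le> (\<Sum>i<N. \<bar>z i\<bar>)" using i by (intro member_le_sum) auto
    also have "\<dots> = (\<Sum>i<N. x i + x (N + i))" by (intro sum.cong) (auto simp: x_def)
    finally show ?thesis by (simp add: sum_lessThan_add sum.distrib)
  qed
  then have "(\<Sum>i<N + N. x i) ^ r\<^sup>2 > 0" by (rule zero_less_power)
  ultimately have "mp_eval x (Pol_numerator r N D q) \<ge> 0"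
    by (meson mult_less_0_iff not_less)
  moreover have "mp_eval (\<lambda>i. x i - x (N + i)) q = mp_eval z q"
    using q by (intro mp_eval_form_cong[of N "2 * D"]) (auto simp: Pol_iff x_def)
  moreover have "(\<Sum>i<N. x i ^ 2 + x (N + i) ^ 2) = (\<Sum>i<N. z i ^ 2)"
    by (intro sum.cong) (auto simp: x_def max_def)
  ultimately show ?thesis by (simp add: mp_eval_Pol_numerator)
qed

text \<open>
  By homogeneity it suffices to bound the form on the unit sphere, where it attains a minimum. Only
  the first \<open>N\<close> coordinates of a point matter; the others are set to \<open>0\<close> so that the
  sphere becomes a compact subset of the space of all sequences.
\<close>

lemma positive_form_lower_bound:
  assumes q: "is_form N (2 * D) q" and D: "D > 0" and N: "N > 0"
    and pos: "\<And>z. \<exists>i<N. z i \<noteq> 0 \<Longrightarrow> mp_eval z q > 0"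
  obtains c where "c > 0" "\<And>z. mp_eval z q \<ge> c * (\<Sum>i<N. z i ^ 2) ^ D"
proof -
  define K where "K = (PiE UNIV (\<lambda>i. if i < N then {-1..1::real} else {0})) \<inter> {z. (\<Sum>i<N. z i ^ 2) = 1}"
  have "compactin (product_topology (\<lambda>i. euclidean) UNIV)
      (PiE UNIV (\<lambda>i. if i < N then {-1..1::real} else {0}))"
    by (subst compactin_PiE) auto
  then have "compact (PiE UNIV (\<lambda>i. if i < N then {-1..1::real} else {0}))"
    by (simp add: euclidean_product_topology)
  moreover have "closed {z :: nat \<Rightarrow> real. (\<Sum>i<N. z i ^ 2) = 1}"
    by (intro closed_Collect_eq continuous_on_sum continuous_on_power continuous_on_const
        continuous_on_product_coordinates)
  ultimately have "compact K" unfolding K_def by (rule compact_Int_closed)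
  moreover have "(\<lambda>i. if i = 0 then 1 else 0) \<in> K"
    using N by (auto simp: K_def if_distrib[of "\<lambda>x. x ^ 2"] cong: if_cong)
  moreover have "continuous_on K (\<lambda>z. mp_eval z q)"
    by (rule continuous_on_subset[OF mp_eval_continuous]) simp
  ultimately obtain w where w: "w \<in> K" "\<And>z. z \<in> K \<Longrightarrow> mp_eval w q \<le> mp_eval z q"
    using continuous_attains_inf[of K "\<lambda>z. mp_eval z q"] by blast
  have "\<exists>i<N. w i \<noteq> 0"
  proof (rule ccontr)
    assume "\<not> ?thesis"
    then have "(\<Sum>i<N. w i ^ 2) = 0" by simp
    with w(1) show False by (simp add: K_def)
  qed
  then have "mp_eval w q > 0" by (rule pos)
  moreover have "mp_eval z q \<ge> mp_eval w q * (\<Sum>i<N. z i ^ 2) ^ D" for z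
  proof -
    define s where "s = sqrt (\<Sum>i<N. z i ^ 2)"
    have s_sq: "s ^ 2 = (\<Sum>i<N. z i ^ 2)"
      unfolding s_def by (intro real_sqrt_pow2 sum_nonneg) simp
    have s_ge: "\<bar>z i\<bar> \<le> s" if "i < N" for i
    proof -
      have "z i ^ 2 \<le> (\<Sum>i<N. z i ^ 2)" using that by (intro member_le_sum) auto
      then show ?thesis unfolding s_def using real_le_rsqrt[of "\<bar>z i\<bar>"] by simp
    qed
    define z' where "z' = (\<lambda>i. if i < N then z i / s else 0)"
    have "mp_eval z q = mp_eval (\<lambda>i. s * z' i) q"
      using s_ge by (intro mp_eval_form_cong[OF q]) (auto simp: z'_def)
    also have "\<dots> = s ^ (2 * D) * mp_eval z' q" by (rule mp_eval_form_scale[OF q])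
    finally have eq: "mp_eval z q = (\<Sum>i<N. z i ^ 2) ^ D * mp_eval z' q"
      by (simp add: power_mult s_sq)
    show ?thesis
    proof (cases "s = 0")
      case True
      then show ?thesis using eq s_sq D by (simp add: zero_power)
    next
      case False
      then have "s > 0" using s_sq unfolding s_def by (simp add: sum_nonneg less_le)
      then have "z' i \<in> (if i < N then {-1..1} else {0})" for i
        using s_ge[of i] by (auto simp: z'_def field_simps abs_le_iff)
      moreover have "(\<Sum>i<N. z' i ^ 2) = (\<Sum>i<N. z i ^ 2) / s ^ 2"
        by (simp add: z'_def power_divide sum_divide_distrib)
      ultimately have "z' \<in> K"
        using False s_sq unfolding K_def by (auto simp: PiE_def)
      then have "mp_eval w q \<le> mp_eval z' q" by (rule w(2))
      then show ?thesis
        unfolding eq by (subst mult.commute) (simp add: mult_left_mono sum_nonneg)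
    qed
  qed
  ultimately show ?thesis using that by blast
qed

text \<open>
  Let \<open>q \<ge> c |z|\<^sup>2\<^sup>D\<close>. Once \<open>1 / r \<le> c\<close>, subtracting \<open>|z|\<^sup>2\<^sup>D / r\<close> leaves a
  nonnegative form, and the perturbation in \<open>Pol\<close> makes the numerator at least \<open>1 / (2 r)\<close> times
  the \<open>D\<close>-th power of a sum of squares, which is bounded below on the simplex. The numerator is
  affine in \<open>1 / r\<close>, so \<open>polya_quadratic_exponent\<close> applies to it.
\<close>

lemma positive_form_in_Pol:
  assumes q: "is_form N (2 * D) q" and D: "D > 0" and N: "N > 0"
    and pos: "\<And>z. \<exists>i<N. z i \<noteq> 0 \<Longrightarrow> mp_eval z q > 0"
  obtains r where "r \<ge> 1" "q - mp_const (1 / real r) * (\<Sum>i<N. mp_var i ^ 2) ^ D \<in> Pol r N D"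
proof -
  obtain c where c: "c > 0" "\<And>z. mp_eval z q \<ge> c * (\<Sum>i<N. z i ^ 2) ^ D"
    using positive_form_lower_bound[OF assms] by blast
  let ?lift = "mp_subst (\<lambda>i. mp_var i - mp_var (N + i))"
  define P :: mpoly where "P = (\<Sum>i<N. mp_var i ^ 2) ^ D"
  define Q :: mpoly where "Q = (\<Sum>i<N. mp_var i ^ 2 + mp_var (N + i) ^ 2) ^ D"
  define B where "B = mp_const (1 / 2) * Q - ?lift P"
  have P: "is_form N (2 * D) P"
    unfolding P_def by (intro is_form_power is_form_sum is_form_var_power) auto
  have Q: "is_form (N + N) (2 * D) Q"
    unfolding Q_def by (intro is_form_power is_form_sum is_form_add is_form_var_power) auto
  have lift: "is_form (N + N) (2 * D) (?lift p)" if "is_form N (2 * D) p" for p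
    using that by (rule is_form_subst) (intro is_form_diff is_form_var; simp)
  have numerator: "Pol_numerator r N D (q - mp_const (1 / real r) * P)
      = ?lift q + mp_const (1 / real r) * B" for r
  proof -
    have "mp_const (1 / (2 * real r)) = mp_const (1 / real r) * mp_const (1 / 2)"
      by (simp add: mult.commute flip: subst.h_mult)
    then show ?thesis
      by (simp add: Pol_numerator_def B_def Q_def mp_subst_simps algebra_simps)
  qed
  have eval: "mp_eval x (?lift q + mp_const (1 / real r) * B)
      \<ge> (1 / 2 * (1 / real (N + N)) ^ D) / real r"
    if r: "r \<ge> max 1 (nat \<lceil>1 / c\<rceil>)" and x: "(\<Sum>i<N + N. x i) = 1" for r x
  proof -
    define z where "z = (\<lambda>i. x i - x (N + i))"
    have "1 / c \<le> real (nat \<lceil>1 / c\<rceil>)" by (rule real_nat_ceiling_ge)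
    also have "\<dots> \<le> real r" using r by simp
    finally have "1 / real r \<le> c" using c(1) r by (simp add: field_simps)
    then have "1 / real r * (\<Sum>i<N. z i ^ 2) ^ D \<le> c * (\<Sum>i<N. z i ^ 2) ^ D"
      by (rule mult_right_mono) (simp add: sum_nonneg)
    also have "\<dots> \<le> mp_eval z q" by (rule c(2))
    finally have "mp_eval z (q - mp_const (1 / real r) * P) \<ge> 0"
      by (simp add: P_def mp_eval_simps)
    \<comment> \<open>Cauchy-Schwarz: \<open>2N\<close> numbers with sum \<open>1\<close> have a sum of squares of at least \<open>1 / 2N\<close>\<close>
    moreover have "(1 / real (N + N)) ^ D \<le> (\<Sum>i<N. x i ^ 2 + x (N + i) ^ 2) ^ D"
    proof (rule power_mono)
      have "(\<Sum>i<N + N. x i)\<^sup>2 \<le> (\<Sum>i<N + N. x i ^ 2) * card {..<N + N}"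
        by (rule sum_squared_le_sum_of_squares)
      then have "1 \<le> (\<Sum>i<N + N. x i ^ 2) * real (N + N)" using x by simp
      then show "1 / real (N + N) \<le> (\<Sum>i<N. x i ^ 2 + x (N + i) ^ 2)"
        using N by (simp add: sum_lessThan_add sum.distrib divide_le_eq)
    qed simp
    then have "1 / (2 * real r) * (1 / real (N + N)) ^ D
        \<le> 1 / (2 * real r) * (\<Sum>i<N. x i ^ 2 + x (N + i) ^ 2) ^ D"
      by (rule mult_left_mono) simp
    ultimately show ?thesis
      unfolding numerator[symmetric] mp_eval_Pol_numerator z_def by simp
  qed
  obtain r where r: "r \<ge> 1"
    "nonneg_coeffs ((?lift q + mp_const (1 / real r) * B) * var_sum (N + N) ^ r\<^sup>2)"
  proof (rule polya_quadratic_exponent[of "N + N" "2 * D" "?lift q" B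
        "1 / 2 * (1 / real (N + N)) ^ D" "max 1 (nat \<lceil>1 / c\<rceil>)"])
    show "is_form (N + N) (2 * D) B"
      unfolding B_def by (intro is_form_diff is_form_const_mult Q lift P)
  qed (use N eval lift[OF q] in auto)
  have "nonneg_coeffs (mp_var i)" for i
    by (simp add: mp_var_def nonneg_coeffs_single)
  then have "nonneg_coeffs (mp_var i ^ 2)" for i
    by (simp add: power2_eq_square nonneg_coeffs_mult)
  with r(2) have "q - mp_const (1 / real r) * P \<in> Pol r N D"
    unfolding Pol_iff numerator
    by (intro conjI nonneg_coeffs_subst is_form_diff is_form_const_mult q P)
  with r(1) show ?thesis using that unfolding P_def by blast
qed

section \<open>The form \<open>f\<^sub>\<gamma>\<close> and the optimal value\<close>

locale optimization_problem =
  fixes n m d :: nat and p :: mpoly and g :: "nat \<Rightarrow> mpoly"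
    and R \<beta> :: real and \<eta> :: "nat \<Rightarrow> real"
  assumes vars_p: "mp_vars p \<subseteq> {..<n}"
    and vars_g: "i \<in> {1..m} \<Longrightarrow> mp_vars (g i) \<subseteq> {..<n}"
    and d_pos: "d \<ge> 1"
    and degree_p: "mp_degree p \<le> 2 * d"
    and degree_g: "i \<in> {1..m} \<Longrightarrow> mp_degree (g i) \<le> 2 * d"
    and ball: "x \<in> feasible_set n m g \<Longrightarrow> (\<Sum>i<n. x i ^ 2) \<le> R"
    and g_le: "x \<in> feasible_set n m g \<Longrightarrow> i \<in> {1..m} \<Longrightarrow> mp_eval x (g i) \<le> \<eta> i"
    and p_ge: "x \<in> feasible_set n m g \<Longrightarrow> - mp_eval x p \<le> \<beta>"
begin

abbreviation N :: nat where "N \<equiv> n + m + 3"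
abbreviation Y :: nat where "Y \<equiv> n + m + 2"
abbreviation f :: "real \<Rightarrow> mpoly" where "f \<gamma> \<equiv> f_form n m p g d R \<eta> \<beta> \<gamma>"

lemma is_form_f: "is_form N (2 * (2 * d)) (f \<gamma>)"
proof -
  have s: "is_form N (2 * d) (mp_var (n + i) ^ 2 * mp_var Y ^ (2 * d - 2))" if "i \<le> m" for i
  proof -
    have "is_form N (2 + (2 * d - 2)) (mp_var (n + i) ^ 2 * mp_var Y ^ (2 * d - 2))"
      using that by (intro is_form_mult is_form_var_power) auto
    moreover have "2 + (2 * d - 2) = 2 * d" using d_pos by simp
    ultimately show ?thesis by simp
  qed
  have h: "is_form N (2 * d) (homogenize (2 * d) Y q)"
    if "mp_vars q \<subseteq> {..<n}" "mp_degree q \<le> 2 * d" for q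
    using that by (intro is_form_homogenize) auto
  have y: "is_form N (2 * d) (mp_var Y ^ (2 * d))"
    by (rule is_form_var_power) simp
  have last: "is_form N (2 * d) (mp_var (n + (m + 1)) ^ (2 * d))"
    by (rule is_form_var_power) simp
  have q: "is_form N (2 * d) (((\<Sum>i<n. mp_var i ^ 2) + (\<Sum>i\<in>{0..m}. mp_var (n + i) ^ 2)) ^ d)"
    by (intro is_form_power is_form_add is_form_sum is_form_var_power) auto
  have square: "is_form N (2 * (2 * d)) (F ^ 2)" if "is_form N (2 * d) F" for F
    using is_form_power[OF that, of 2] by (simp add: mult.commute)
  have "is_form N (2 * d)
      (mp_const \<gamma> * mp_var Y ^ (2 * d) - homogenize (2 * d) Y p
        - mp_var (n + 0) ^ 2 * mp_var Y ^ (2 * d - 2))"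
    using vars_p degree_p by (intro is_form_diff is_form_const_mult y h s) auto
  moreover have "is_form N (2 * d)
      (homogenize (2 * d) Y (g i) - mp_var (n + i) ^ 2 * mp_var Y ^ (2 * d - 2))"
    if "i \<in> {1..m}" for i
    using that vars_g degree_g by (intro is_form_diff h s) auto
  moreover have "is_form N (2 * d)
      (mp_const c * mp_var Y ^ (2 * d)
        - ((\<Sum>i<n. mp_var i ^ 2) + (\<Sum>i\<in>{0..m}. mp_var (n + i) ^ 2)) ^ d
        - mp_var (n + (m + 1)) ^ (2 * d))" for c
    by (intro is_form_diff is_form_const_mult y q last)
  ultimately show ?thesis
    unfolding f_form_def Let_def by (intro is_form_add is_form_sum square)
qed

lemma eval_f:
  assumes "z Y = 1"
  shows "mp_eval z (f \<gamma>) = (\<gamma> - mp_eval z p - z n ^ 2) ^ 2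
    + (\<Sum>i\<in>{1..m}. (mp_eval z (g i) - z (n + i) ^ 2) ^ 2)
    + ((R + (\<Sum>i\<in>{1..m}. \<eta> i) + \<beta> + \<gamma>) ^ d
        - ((\<Sum>i<n. z i ^ 2) + (\<Sum>i\<in>{0..m}. z (n + i) ^ 2)) ^ d - z (n + m + 1) ^ (2 * d)) ^ 2"
  using assms
  by (simp add: f_form_def Let_def mp_eval_simps mp_eval_homogenize)

text \<open>
  At \<open>y = 0\<close> the last square retains the pure powers of the \<open>x\<close> and \<open>s\<close> variables, which leave no
  room for a zero at infinity. This is the purpose of the third summand of \<open>f\<^sub>\<gamma>\<close>.
\<close>

lemma eval_f_at_infinity:
  assumes "z Y = 0"
  shows "mp_eval z (f \<gamma>)
    \<ge> (((\<Sum>i<n. z i ^ 2) + (\<Sum>i\<in>{0..m}. z (n + i) ^ 2)) ^ d + z (n + m + 1) ^ (2 * d)) ^ 2"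
proof -
  let ?Q = "(\<Sum>i<n. z i ^ 2) + (\<Sum>i\<in>{0..m}. z (n + i) ^ 2)"
  have "((R + (\<Sum>i\<in>{1..m}. \<eta> i) + \<beta> + \<gamma>) ^ d * z Y ^ (2 * d) - ?Q ^ d - z (n + m + 1) ^ (2 * d)) ^ 2
      \<le> mp_eval z (f \<gamma>)"
    by (simp add: f_form_def Let_def mp_eval_simps sum_nonneg)
  moreover have "z Y ^ (2 * d) = 0" using assms d_pos by (simp add: zero_power)
  moreover have "(0 - ?Q ^ d - z (n + m + 1) ^ (2 * d)) ^ 2 = (?Q ^ d + z (n + m + 1) ^ (2 * d)) ^ 2"
    by (simp add: power2_eq_square algebra_simps)
  ultimately show ?thesis by (simp only: mult_zero_right)
qed

text \<open>
  A zero with \<open>y \<noteq> 0\<close> can be scaled to \<open>y = 1\<close>; then \<open>g\<^sub>i(x) = s\<^sub>i\<^sup>2\<close> makes \<open>x\<close> feasible, while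
  \<open>\<gamma> - p(x) = s\<^sub>0\<^sup>2\<close> contradicts \<open>\<gamma> < p(x)\<close>.
\<close>

lemma f_positive:
  assumes \<gamma>: "\<And>x. x \<in> feasible_set n m g \<Longrightarrow> \<gamma> < mp_eval x p"
    and z: "\<exists>i<N. z i \<noteq> 0"
  shows "mp_eval z (f \<gamma>) > 0"
proof (cases "z Y = 0")
  case True
  let ?Q = "(\<Sum>i<n. z i ^ 2) + (\<Sum>i\<in>{0..m}. z (n + i) ^ 2)"
  have Q: "?Q \<ge> 0" by (intro add_nonneg_nonneg sum_nonneg) auto
  have "?Q ^ d + z (n + m + 1) ^ (2 * d) > 0"
  proof (rule ccontr)
    assume "\<not> ?thesis"
    moreover have "?Q ^ d \<ge> 0" "z (n + m + 1) ^ (2 * d) \<ge> 0"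
      using Q by (simp_all add: power_mult)
    ultimately have "?Q ^ d = 0" "z (n + m + 1) ^ (2 * d) = 0" by linarith+
    then have "?Q = 0" and last: "z (n + m + 1) = 0" by simp_all
    then have "(\<Sum>i<n. z i ^ 2) = 0" "(\<Sum>i\<in>{0..m}. z (n + i) ^ 2) = 0"
      using sum_nonneg[of "{..<n}" "\<lambda>i. z i ^ 2"] sum_nonneg[of "{0..m}" "\<lambda>i. z (n + i) ^ 2"]
      by (simp_all add: add_nonneg_eq_0_iff)
    then have x: "\<And>i. i < n \<Longrightarrow> z i = 0" and s: "\<And>i. i \<le> m \<Longrightarrow> z (n + i) = 0"
      by (simp_all add: sum_nonneg_eq_0_iff)
    have "z i = 0" if i: "i < N" for i
    proof -
      consider "i < n" | "n \<le> i" "i - n \<le> m" | "i = n + m + 1" | "i = Y"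
        using i by linarith
      then show ?thesis
      proof cases
        case 2
        then show ?thesis using s[of "i - n"] by simp
      qed (use x last True in auto)
    qed
    with z show False by blast
  qed
  then have "0 < (?Q ^ d + z (n + m + 1) ^ (2 * d)) ^ 2" by simp
  also have "\<dots> \<le> mp_eval z (f \<gamma>)" by (rule eval_f_at_infinity[of z, OF True])
  finally show ?thesis .
next
  case False
  define y where "y = (\<lambda>i. z i / z Y)"
  have y: "y Y = 1" using False by (simp add: y_def)
  have "mp_eval y (f \<gamma>) \<noteq> 0"
  proof
    assume eq: "mp_eval y (f \<gamma>) = 0"
    have summands_zero: "a = 0 \<and> b = 0" if "a ^ 2 + b + c ^ 2 = 0" "b \<ge> 0" for a b c :: real
    proof -
      have "a ^ 2 = 0" "b = 0"
        using that zero_le_power2[of a] zero_le_power2[of c] by linarith+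
      then show ?thesis by simp
    qed
    have "\<gamma> - mp_eval y p - y n ^ 2 = 0
        \<and> (\<Sum>i\<in>{1..m}. (mp_eval y (g i) - y (n + i) ^ 2) ^ 2) = 0"
      by (rule summands_zero[OF eq[unfolded eval_f[of y, OF y]]]) (simp add: sum_nonneg)
    then have p0: "\<gamma> - mp_eval y p - y n ^ 2 = 0"
      and "(\<Sum>i\<in>{1..m}. (mp_eval y (g i) - y (n + i) ^ 2) ^ 2) = 0" by blast+
    then have g0: "\<forall>i\<in>{1..m}. mp_eval y (g i) = y (n + i) ^ 2"
      by (simp add: sum_nonneg_eq_0_iff)
    define x where "x = restrict y {..<n}"
    have "mp_eval x q = mp_eval y q" if "mp_vars q \<subseteq> {..<n}" for q
      using that by (intro mp_eval_cong) (auto simp: x_def)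
    then have eval: "mp_eval x p = mp_eval y p" "\<And>i. i \<in> {1..m} \<Longrightarrow> mp_eval x (g i) = mp_eval y (g i)"
      using vars_p vars_g by blast+
    have "x \<in> feasible_set n m g"
      using eval g0 by (auto simp: feasible_set_def x_def)
    then have "\<gamma> < mp_eval y p" using \<gamma>[of x] eval(1) by simp
    with p0 show False using zero_le_power2[of "y n"] by linarith
  qed
  moreover have "mp_eval y (f \<gamma>) \<ge> 0"
    unfolding eval_f[of y, OF y] by (intro add_nonneg_nonneg sum_nonneg) auto
  moreover have "mp_eval z (f \<gamma>) = z Y ^ (2 * (2 * d)) * mp_eval y (f \<gamma>)"
    using mp_eval_form_scale[OF is_form_f, of "z Y" y \<gamma>] False by (simp add: y_def)
  moreover have "z Y ^ (2 * (2 * d)) > 0" using False by (simp add: power_mult)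
  ultimately show ?thesis by simp
qed

text \<open>
  Conversely, a feasible point with \<open>p(x) \<le> \<gamma>\<close> extends to a zero of \<open>f\<^sub>\<gamma>\<close> by taking square roots as
  slack variables. The bounds \<open>R\<close>, \<open>\<eta>\<^sub>i\<close> and \<open>\<beta>\<close> ensure that the last equation can be solved for
  \<open>s\<^sub>m\<^sub>+\<^sub>1\<close>.
\<close>

lemma f_zero:
  assumes x: "x \<in> feasible_set n m g" and \<gamma>: "mp_eval x p \<le> \<gamma>"
  obtains z where "z Y = 1" "mp_eval z (f \<gamma>) = 0"
proof
  define s where "s = (\<lambda>i. if i = 0 then sqrt (\<gamma> - mp_eval x p) else sqrt (mp_eval x (g i)))"
  define C where "C = R + (\<Sum>i\<in>{1..m}. \<eta> i) + \<beta> + \<gamma>"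
  define Q where "Q = (\<Sum>i<n. x i ^ 2) + (\<Sum>i\<in>{0..m}. s i ^ 2)"
  define z where "z = (\<lambda>i. if i < n then x i else if i \<le> n + m then s (i - n)
    else if i = n + m + 1 then root (2 * d) (C ^ d - Q ^ d) else 1)"
  show y: "z Y = 1" by (simp add: z_def)
  have s_sq: "s 0 ^ 2 = \<gamma> - mp_eval x p" "\<And>i. i \<in> {1..m} \<Longrightarrow> s i ^ 2 = mp_eval x (g i)"
    using x \<gamma> by (auto simp: s_def feasible_set_def)
  have "(\<Sum>i\<in>{0..m}. s i ^ 2) = s 0 ^ 2 + (\<Sum>i\<in>{1..m}. s i ^ 2)"
    by (simp add: sum.atLeast_Suc_atMost)
  also have "\<dots> = \<gamma> - mp_eval x p + (\<Sum>i\<in>{1..m}. mp_eval x (g i))"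
    by (simp add: s_sq)
  also have "\<dots> \<le> \<gamma> + \<beta> + (\<Sum>i\<in>{1..m}. \<eta> i)"
    using p_ge[OF x] sum_mono[of "{1..m}" "\<lambda>i. mp_eval x (g i)" \<eta>] g_le[OF x] by simp
  finally have "Q \<le> C" using ball[OF x] by (simp add: Q_def C_def)
  moreover have "Q \<ge> 0" unfolding Q_def by (intro add_nonneg_nonneg sum_nonneg) auto
  ultimately have "C ^ d - Q ^ d \<ge> 0" by (simp add: power_mono)
  then have last: "z (n + m + 1) ^ (2 * d) = C ^ d - Q ^ d"
    using d_pos by (simp add: z_def)
  have "mp_eval z q = mp_eval x q" if "mp_vars q \<subseteq> {..<n}" for q
    using that by (intro mp_eval_cong) (auto simp: z_def)
  then have eval: "mp_eval z p = mp_eval x p" "\<And>i. i \<in> {1..m} \<Longrightarrow> mp_eval z (g i) = mp_eval x (g i)"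
    using vars_p vars_g by blast+
  have z_s: "z (n + i) = s i" if "i \<le> m" for i using that by (simp add: z_def)
  have "(\<Sum>i<n. z i ^ 2) + (\<Sum>i\<in>{0..m}. z (n + i) ^ 2) = Q"
    by (simp add: Q_def z_s) (simp add: z_def)
  then show "mp_eval z (f \<gamma>) = 0"
    unfolding eval_f[of z, OF y] last C_def[symmetric] eval(1)
    using z_s[of 0] s_sq eval(2) z_s by (simp add: sum.neutral)
qed

section \<open>The hierarchy of lower bounds\<close>

definition certified :: "nat \<Rightarrow> real set" where
  "certified r = {\<gamma>. f \<gamma> - mp_const (1 / real r) * (\<Sum>i<N. mp_var i ^ 2) ^ (2 * d) \<in> Pol r N (2 * d)}"

text \<open>
  Membership in \<open>Pol\<close> gives \<open>f\<^sub>\<gamma>(z) \<ge> |z|\<^sup>4\<^sup>d / (2 r)\<close>, because half of the subtracted multiple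
  of \<open>|z|\<^sup>4\<^sup>d\<close> survives the perturbation; hence \<open>f\<^sub>\<gamma>\<close> has no nontrivial zero.
\<close>

lemma certified_le_opt:
  assumes \<gamma>: "\<gamma> \<in> certified r" and r: "r \<ge> 1"
  shows "ereal \<gamma> \<le> opt_value n m p g"
  unfolding opt_value_def
proof (rule INF_greatest)
  fix x assume x: "x \<in> feasible_set n m g"
  show "ereal \<gamma> \<le> ereal (mp_eval x p)"
  proof (rule ccontr)
    assume "\<not> ?thesis"
    then obtain z where z: "z Y = 1" "mp_eval z (f \<gamma>) = 0"
      using f_zero[OF x, of \<gamma>] by auto
    define S where "S = (\<Sum>i<N. z i ^ 2)"
    have "1 \<le> S"
      unfolding S_def using member_le_sum[of Y "{..<N}" "\<lambda>i. z i ^ 2"] z(1) by simp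
    then have "S ^ (2 * d) > 0" by simp
    have "mp_eval z (f \<gamma> - mp_const (1 / real r) * (\<Sum>i<N. mp_var i ^ 2) ^ (2 * d))
        + 1 / (2 * real r) * S ^ (2 * d) \<ge> 0"
      unfolding S_def using \<gamma> z(1) by (intro Pol_eval_lower_bound[where i = Y]) (auto simp: certified_def)
    then have "1 / real r * S ^ (2 * d) \<le> 1 / (2 * real r) * S ^ (2 * d)"
      using z(2) by (simp add: mp_eval_simps S_def)
    with \<open>S ^ (2 * d) > 0\<close> r show False by (simp add: field_simps)
  qed
qed

lemma certified_exists:
  assumes "ereal \<gamma> < opt_value n m p g"
  obtains r where "r \<ge> 1" "\<gamma> \<in> certified r"
proof -
  have "\<gamma> < mp_eval x p" if "x \<in> feasible_set n m g" for x
  proof -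
    have "opt_value n m p g \<le> ereal (mp_eval x p)"
      unfolding opt_value_def by (rule INF_lower[OF that])
    with assms have "ereal \<gamma> < ereal (mp_eval x p)" by (rule less_le_trans)
    then show ?thesis by simp
  qed
  then have "mp_eval z (f \<gamma>) > 0" if "\<exists>i<N. z i \<noteq> 0" for z
    using f_positive that by blast
  then show ?thesis
    using positive_form_in_Pol[of N "2 * d" "f \<gamma>"] is_form_f d_pos that
    unfolding certified_def by auto
qed

lemma l_bound_eq: "l_bound n m p g d R \<eta> \<beta> r = Sup (ereal ` certified r)"
  by (simp add: l_bound_def certified_def)

lemma m_bound_le_opt:
  assumes "r \<ge> 1"
  shows "m_bound n m p g d R \<eta> \<beta> r \<le> opt_value n m p g"
  unfolding m_bound_def l_bound_eq using assms
  by (subst Max_le_iff) (auto intro!: Sup_least certified_le_opt)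

lemma m_bound_mono: "mono_on {1..} (m_bound n m p g d R \<eta> \<beta>)"
  unfolding m_bound_def by (intro mono_onI Max_mono) auto

text \<open>
  Each \<open>\<gamma>\<close> below the optimal value is certified at some level, and the maximum over all lower
  levels carries it on to every later one.
\<close>

lemma m_bound_tendsto: "m_bound n m p g d R \<eta> \<beta> \<longlonglongrightarrow> opt_value n m p g"
proof (rule order_tendstoI)
  fix a assume "a < opt_value n m p g"
  then obtain \<gamma> where \<gamma>: "a < ereal \<gamma>" "ereal \<gamma> < opt_value n m p g"
    using ereal_dense3 by blast
  then obtain r0 where r0: "r0 \<ge> 1" "\<gamma> \<in> certified r0"
    using certified_exists by blast
  have "a < m_bound n m p g d R \<eta> \<beta> r" if "r \<ge> r0" for r
  proof -
    have "ereal \<gamma> \<le> l_bound n m p g d R \<eta> \<beta> r0"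
      unfolding l_bound_eq using r0(2) by (intro Sup_upper) auto
    also have "\<dots> \<le> m_bound n m p g d R \<eta> \<beta> r"
      unfolding m_bound_def using r0(1) that by (intro Max_ge) auto
    finally show ?thesis using \<gamma>(1) by simp
  qed
  then show "\<forall>\<^sub>F r in sequentially. a < m_bound n m p g d R \<eta> \<beta> r"
    unfolding eventually_sequentially by blast
next
  fix a assume "opt_value n m p g < a"
  then show "\<forall>\<^sub>F r in sequentially. m_bound n m p g d R \<eta> \<beta> r < a"
    using m_bound_le_opt le_less_trans unfolding eventually_sequentially by blast
qed

end

theorem theorem4p4p1:
  fixes n m d :: nat and p :: mpoly and g :: "nat \<Rightarrow> mpoly"
    and R \<beta> :: real and \<eta> :: "nat \<Rightarrow> real"
  assumes "mp_vars p \<subseteq> {..<n}"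
    and "\<forall>i\<in>{1..m}. mp_vars (g i) \<subseteq> {..<n}"
    and "d = (LEAST k. 1 \<le> k \<and> mp_degree p \<le> 2 * k \<and> (\<forall>i\<in>{1..m}. mp_degree (g i) \<le> 2 * k))"
    and "R > 0"
    and "\<forall>x\<in>feasible_set n m g. (\<Sum>i<n. x i ^ 2) \<le> R"
    and "\<forall>x\<in>feasible_set n m g. \<forall>i\<in>{1..m}. mp_eval x (g i) \<le> \<eta> i"
    and "\<forall>x\<in>feasible_set n m g. - mp_eval x p \<le> \<beta>"
  shows "(\<forall>r\<ge>1. m_bound n m p g d R \<eta> \<beta> r \<le> opt_value n m p g)
    \<and> mono_on {1..} (m_bound n m p g d R \<eta> \<beta>)
    \<and> m_bound n m p g d R \<eta> \<beta> \<longlonglongrightarrow> opt_value n m p g"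
proof -
  let ?P = "\<lambda>k. 1 \<le> k \<and> mp_degree p \<le> 2 * k \<and> (\<forall>i\<in>{1..m}. mp_degree (g i) \<le> 2 * k)"
  let ?k = "1 + mp_degree p + (\<Sum>i\<in>{1..m}. mp_degree (g i))"
  have "mp_degree (g i) \<le> 2 * ?k" if "i \<in> {1..m}" for i
    using member_le_sum[of i "{1..m}" "\<lambda>i. mp_degree (g i)"] that by simp
  then have "?P ?k" by simp
  then have "?P d" unfolding assms(3) by (rule LeastI)
  then interpret optimization_problem n m d p g R \<beta> \<eta>
    using assms by unfold_locales auto
  show ?thesis
    using m_bound_le_opt m_bound_mono m_bound_tendsto by blast
qed

end
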